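(* Let $0<a<b$ be real numbers. Then for all $x\in[a,b]$, $$\left[\frac{A(a,b)}{I(a,b)}\right]^{b-a}\ge\left[\frac{A(a,x)}{I(a,x)}\right]^{x-a}.$$
   Context: For positive reals $u,v$, $A(u,v)=\frac{u+v}{2}$ is the arithmetic mean, and for $u\ne v$, $I(u,v)=\frac1e\left(\frac{v^v}{u^u}\right)^{\frac{1}{v-u}}$ is the identric mean, with the usual convention $I(u,u)=u$. *)

theory Defs
  imports Complex_Main
begin

definition arith_mean :: "real \<Rightarrow> real \<Rightarrow> real" where
  "arith_mean u v = (u + v) / 2"

definition identric_mean :: "real \<Rightarrow> real \<Rightarrow> real" where
  "identric_mean u v =
    (if u = v then u
     else 1 / exp 1 * ((v powr v) / (u powr u)) powr (1 / (v - u)))"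

end

theory Submission
  imports Defs
begin

text \<open>
  For fixed \<open>a\<close>, taking the logarithm of \<open>(A(a,x) / I(a,x)) powr (x - a)\<close> clears the
  exponent \<open>1 / (x - a)\<close> in the identric mean and leaves the function
  \<open>g(x) = (x - a) * ln ((a + x) / 2) + (x - a) - x * ln x + a * ln a\<close>,
  which is differentiable on the whole positive half-line, also at \<open>x = a\<close>. Its derivative is
  \<open>g'(x) = (s - 1) - ln s\<close> with \<open>s = 2 * x / (a + x)\<close>, which is nonnegative. So \<open>g\<close> is
  increasing (\<open>log_mean_ratio_powr_mono\<close>), and the theorem compares \<open>g(x)\<close> with \<open>g(b)\<close>
  through \<open>mean_ratio_powr_eq_exp\<close>.
\<close>

definition log_mean_ratio_powr :: "real \<Rightarrow> real \<Rightarrow> real" where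
  "log_mean_ratio_powr a x = (x - a) * ln ((a + x) / 2) + (x - a) - x * ln x + a * ln a"

lemma ln_identric_mean:
  assumes "0 < u" "0 < v" "u \<noteq> v"
  shows "ln (identric_mean u v) = (v * ln v - u * ln u) / (v - u) - 1"
  using assms by (simp add: identric_mean_def ln_mult ln_div)

lemma identric_mean_pos:
  assumes "0 < u" "0 < v"
  shows "0 < identric_mean u v"
  using assms by (simp add: identric_mean_def)

lemma mean_ratio_powr_eq_exp:
  assumes "0 < a" "0 < x"
  shows "(arith_mean a x / identric_mean a x) powr (x - a) = exp (log_mean_ratio_powr a x)"
proof (cases "x = a")
  case True
  then show ?thesis
    using assms by (simp add: arith_mean_def identric_mean_def log_mean_ratio_powr_def)
next
  case False
  have pos: "0 < arith_mean a x" "0 < identric_mean a x"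
    using assms by (simp_all add: arith_mean_def identric_mean_pos)
  have "(x - a) * ln (arith_mean a x / identric_mean a x)
      = (x - a) * ln (arith_mean a x) - (x - a) * ln (identric_mean a x)"
    using pos by (simp add: ln_div right_diff_distrib)
  also have "(x - a) * ln (identric_mean a x) = x * ln x - a * ln a - (x - a)"
    using assms False
    by (simp add: ln_identric_mean right_diff_distrib [of "x - a" "_ / _"]
        del: times_divide_eq_right) simp
  finally show ?thesis
    using pos by (simp add: powr_def arith_mean_def log_mean_ratio_powr_def)
qed

lemma log_mean_ratio_powr_has_derivative:
  assumes "0 < a" "0 < x"
  shows "(log_mean_ratio_powr a has_real_derivative
           ln ((a + x) / 2) + (x - a) / (a + x) - ln x) (at x)"
proof -
  have "((\<lambda>x. (x - a) * ln ((a + x) / 2) + (x - a) - x * ln x + a * ln a) has_real_derivative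
          (1 * ln ((a + x) / 2) + (1 / 2) / ((a + x) / 2) * (x - a)) + 1
            - (1 * ln x + 1 / x * x)) (at x)"
    using assms by (auto intro!: derivative_eq_intros simp: frac_eq_eq) (simp add: algebra_simps)
  moreover have "(1 / 2) / ((a + x) / 2) * (x - a) = (x - a) / (a + x)"
    by simp
  ultimately show ?thesis
    using assms by (simp only: log_mean_ratio_powr_def [abs_def]) simp
qed

text \<open>The inequality \<open>ln s \<le> s - 1\<close> is applied to \<open>s\<close>, the ratio of \<open>x\<close> to the midpoint of
  \<open>a\<close> and \<open>x\<close>, for which \<open>s - 1\<close> is exactly the rational part of the derivative.\<close>

lemma log_mean_ratio_powr_derivative_nonneg:
  fixes a x :: real
  assumes "0 < a" "0 < x"
  shows "0 \<le> ln ((a + x) / 2) + (x - a) / (a + x) - ln x"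
proof -
  have "ln x - ln ((a + x) / 2) = ln (x / ((a + x) / 2))"
    using assms by (subst ln_div) auto
  also have "\<dots> \<le> x / ((a + x) / 2) - 1"
    using assms by (intro ln_le_minus_one) simp
  also have "\<dots> = (x - a) / (a + x)"
    using assms by (simp add: field_simps)
  finally show ?thesis by simp
qed

lemma log_mean_ratio_powr_mono:
  assumes "0 < a" "0 < x" "x \<le> y"
  shows "log_mean_ratio_powr a x \<le> log_mean_ratio_powr a y"
proof (rule DERIV_nonneg_imp_nondecreasing [OF \<open>x \<le> y\<close>])
  fix z assume "x \<le> z" "z \<le> y"
  with assms have "0 < z" by simp
  with \<open>0 < a\<close> show "\<exists>d. (log_mean_ratio_powr a has_real_derivative d) (at z) \<and> 0 \<le> d"
    by (blast intro: log_mean_ratio_powr_has_derivative log_mean_ratio_powr_derivative_nonneg)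
qed

theorem mainTheorem8:
  fixes a b x :: real
  assumes "0 < a" and "a < b" and "x \<in> {a..b}"
  shows "(arith_mean a b / identric_mean a b) powr (b - a)
           \<ge> (arith_mean a x / identric_mean a x) powr (x - a)"
  using assms by (simp add: mean_ratio_powr_eq_exp log_mean_ratio_powr_mono)

end
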